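(* Let $a\in[0,\infty)\setminus\{1\}$ and let $\tau$ be a positive integer. There exist a sequence $(\lambda_n)_{n\in\mathbb N}$ of complex numbers, an infinite-dimensional separable complex Banach space $X$, and a bounded linear operator $T$ on $X$ which is not recurrent, such that $$\lim_{n\to\infty}\frac{|\lambda_n|}{|\lambda_{n+\tau}|}=a$$ and the sequence $(\lambda_nT^n)_{n\in\mathbb N}$ is frequently universal.
   Context: $\mathbb N$ denotes the set of positive integers. For $B\subset\mathbb N$ the lower density is $\underline{\mathrm d}(B)=\liminf_{N\to\infty}\frac{|\{n\in B: n\le N\}|}{N}$. A sequence $(T_n)_{n\in\mathbb N}$ of bounded linear operators on $X$ is *frequently universal* if there is a vector $x\in X$ such that for every non-empty open set $U\subset X$ the set $\{n\in\mathbb N: T_nx\in U\}$ has positive lower density. A bounded linear operator $T$ on $X$ is *recurrent* if for every non-empty open set $U\subset X$ there is a positive integer $k$ such that $U\cap T^{-k}U\neq\emptyset$, where $T^{-k}U=(T^k)^{-1}(U)$ denotes the preimage. *)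

theory Defs
  imports "HOL-Analysis.Analysis" "HOL-Algebra.Module"
begin

definition complex_ring :: "complex ring" where
  "complex_ring =
     \<lparr>carrier = UNIV, monoid.mult = (*), one = 1, ring.zero = 0, add = (+)\<rparr>"

text \<open>
  Complex Banach spaces are represented with explicit carriers, since types cannot be
  quantified existentially. As usual for modules in HOL-Algebra, the ring multiplication
  and unit fields inherited by the record are irrelevant. A carrier inside the type
  \<^typ>\<open>nat \<Rightarrow> complex\<close>, with arbitrary operations and norm, loses no generality for
  separable spaces: a separable metric space has at most as many points as this type, so
  every separable Banach space has an isometrically isomorphic copy of this kind.
\<close>

record 'b normed_module = "(complex, 'b) module" +
  nrm :: "'b \<Rightarrow> real"

locale complex_normed_space = module complex_ring X
  for X :: "('b, 'm) normed_module_scheme" (structure) +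
  assumes nrm_eq_0_iff: "x \<in> carrier X \<Longrightarrow> nrm X x = 0 \<longleftrightarrow> x = \<zero>\<^bsub>X\<^esub>"
    and nrm_triangle:
      "x \<in> carrier X \<Longrightarrow> y \<in> carrier X \<Longrightarrow> nrm X (x \<oplus>\<^bsub>X\<^esub> y) \<le> nrm X x + nrm X y"
    and nrm_smult: "x \<in> carrier X \<Longrightarrow> nrm X (c \<odot>\<^bsub>X\<^esub> x) = cmod c * nrm X x"

definition nrm_dist :: "('b, 'm) normed_module_scheme \<Rightarrow> 'b \<Rightarrow> 'b \<Rightarrow> real" where
  "nrm_dist X x y =
     (if x \<in> carrier X \<and> y \<in> carrier X then nrm X (x \<ominus>\<^bsub>X\<^esub> y) else 0)"
  \<comment> \<open>The locale \<open>Metric_space\<close> demands nonnegativity and symmetry on the whole type,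
      hence the value 0 off the carrier.\<close>

definition nrm_topology :: "('b, 'm) normed_module_scheme \<Rightarrow> 'b topology" where
  "nrm_topology X = Metric_space.mtopology (carrier X) (nrm_dist X)"

locale complex_banach_space = complex_normed_space +
  assumes complete: "Metric_space.mcomplete (carrier X) (nrm_dist X)"

definition infinite_dimensional :: "('b, 'm) normed_module_scheme \<Rightarrow> bool" where
  "infinite_dimensional X \<longleftrightarrow>
     \<not> (\<exists>S. finite S \<and> S \<subseteq> carrier X \<and>
          (\<forall>x\<in>carrier X. \<exists>c. x = (\<Oplus>\<^bsub>X\<^esub>s\<in>S. c s \<odot>\<^bsub>X\<^esub> s)))"

definition bounded_linear_operator ::
  "('b, 'm) normed_module_scheme \<Rightarrow> ('b \<Rightarrow> 'b) \<Rightarrow> bool" where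
  "bounded_linear_operator X T \<longleftrightarrow>
     (\<forall>x\<in>carrier X. T x \<in> carrier X) \<and>
     (\<forall>x\<in>carrier X. \<forall>y\<in>carrier X. T (x \<oplus>\<^bsub>X\<^esub> y) = T x \<oplus>\<^bsub>X\<^esub> T y) \<and>
     (\<forall>c. \<forall>x\<in>carrier X. T (c \<odot>\<^bsub>X\<^esub> x) = c \<odot>\<^bsub>X\<^esub> T x) \<and>
     (\<exists>K. \<forall>x\<in>carrier X. nrm X (T x) \<le> K * nrm X x)"

definition recurrent_operator ::
  "('b, 'm) normed_module_scheme \<Rightarrow> ('b \<Rightarrow> 'b) \<Rightarrow> bool" where
  "recurrent_operator X T \<longleftrightarrow>
     (\<forall>U. openin (nrm_topology X) U \<and> U \<noteq> {} \<longrightarrow>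
        (\<exists>k\<ge>1. U \<inter> {x \<in> carrier X. (T ^^ k) x \<in> U} \<noteq> {}))"

text \<open>
  The positive integers are the \<open>n \<ge> 1\<close> in \<^typ>\<open>nat\<close>: a sequence indexed by them is a
  function on \<^typ>\<open>nat\<close> whose value at 0 is disregarded. Division by 0 is 0, so a limit
  of quotients needs an explicit assumption that the denominators do not vanish.
\<close>

definition lower_density :: "nat set \<Rightarrow> ereal" where
  "lower_density B =
     liminf (\<lambda>N. ereal (real (card {n \<in> B. 1 \<le> n \<and> n \<le> N}) / real N))"

definition frequently_universal ::
  "('b, 'm) normed_module_scheme \<Rightarrow> (nat \<Rightarrow> 'b \<Rightarrow> 'b) \<Rightarrow> bool" where
  "frequently_universal X S \<longleftrightarrow>
     (\<exists>x\<in>carrier X. \<forall>U. openin (nrm_topology X) U \<and> U \<noteq> {} \<longrightarrow>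
        lower_density {n. 1 \<le> n \<and> S n x \<in> U} > 0)"

end

theory Submission
  imports Defs "HOL-Library.Function_Algebras" "HOL-Library.Nat_Bijection"
    "HOL-Computational_Algebra.Factorial_Ring"
begin

text \<open>
  \<open>T\<close> is a weighted backward shift on \<open>c\<^sub>0\<close>. If \<open>a < 1\<close>, then \<open>\<lambda>\<^sub>n\<close> grows at least exponentially and
  a unilateral shift with weight below \<open>1\<close> is a strict contraction, hence not recurrent, while
  \<open>\<lambda>\<^sub>n T\<^sup>n\<close> still has exponentially small right inverses. If \<open>a > 1\<close>, then \<open>\<lambda>\<^sub>n\<close> decays exponentially
  and a bilateral shift with all weights above \<open>1\<close> is strictly expanding, hence not recurrent; its
  weights are chosen above the growth rate of \<open>1 / \<lambda>\<^sub>n\<close> on the nonnegative and below it on the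
  negative coordinates. In both cases a frequently universal vector is glued from disjoint blocks:
  at \<open>n = centre i\<close> sits the preimage under \<open>\<lambda>\<^sub>n T\<^sup>n\<close> of a finitely supported vector \<open>y\<^sub>j\<close>, \<open>j = jump i\<close>.
  In the supremum norm the errors caused by the other blocks do not add up, as the blocks are
  disjoint.
\<close>

subsection \<open>The space of null sequences\<close>

text \<open>Forcing the coordinates outside \<open>I\<close> to vanish lets the unilateral and the
  bilateral shift act on spaces of the same type.\<close>

definition c0_space :: "nat set \<Rightarrow> (nat \<Rightarrow> complex) normed_module" where
  "c0_space I =
     \<lparr>carrier = {f. f \<longlonglongrightarrow> 0 \<and> (\<forall>k. k \<notin> I \<longrightarrow> f k = 0)},
      monoid.mult = (\<lambda>f g k. f k * g k), one = (\<lambda>k. 1), ring.zero = (\<lambda>k. 0),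
      add = (\<lambda>f g k. f k + g k), smult = (\<lambda>c f k. c * f k), nrm = (\<lambda>f. SUP k. cmod (f k))\<rparr>"

lemma c0_space_sel [simp]:
  "f \<in> carrier (c0_space I) \<longleftrightarrow> f \<longlonglongrightarrow> 0 \<and> (\<forall>k. k \<notin> I \<longrightarrow> f k = 0)"
  "\<zero>\<^bsub>c0_space I\<^esub> = (\<lambda>k. 0)"
  "f \<oplus>\<^bsub>c0_space I\<^esub> g = (\<lambda>k. f k + g k)"
  "c \<odot>\<^bsub>c0_space I\<^esub> f = (\<lambda>k. c * f k)"
  by (simp_all add: c0_space_def)

lemma cring_complex_ring: "cring complex_ring"
proof (rule cringI)
  show "abelian_group complex_ring"
    by (rule abelian_groupI) (auto simp: complex_ring_def intro: exI[of _ "- x" for x])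
  show "Group.comm_monoid complex_ring"
    by (rule comm_monoidI) (auto simp: complex_ring_def)
qed (auto simp: complex_ring_def algebra_simps)

lemma abelian_group_c0_space: "abelian_group (c0_space I)"
proof (rule abelian_groupI)
  fix x assume "x \<in> carrier (c0_space I)"
  then show "\<exists>y\<in>carrier (c0_space I). y \<oplus>\<^bsub>c0_space I\<^esub> x = \<zero>\<^bsub>c0_space I\<^esub>"
    by (intro bexI[of _ "\<lambda>k. - x k"]) (auto intro: tendsto_eq_intros)
qed (auto simp: algebra_simps intro: tendsto_eq_intros)

lemma module_c0_space: "module complex_ring (c0_space I)"
  by (rule moduleI[OF cring_complex_ring abelian_group_c0_space])
     (auto simp: complex_ring_def algebra_simps intro: tendsto_eq_intros)

lemma c0_space_minus:
  assumes "f \<in> carrier (c0_space I)" "g \<in> carrier (c0_space I)"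
  shows "f \<ominus>\<^bsub>c0_space I\<^esub> g = (\<lambda>k. f k - g k)"
proof -
  interpret abelian_group "c0_space I" by (rule abelian_group_c0_space)
  have "\<ominus>\<^bsub>c0_space I\<^esub> g = (\<lambda>k. - g k)"
    using assms by (intro minus_equality) (auto intro: tendsto_eq_intros)
  then show ?thesis by (simp add: a_minus_def)
qed

section \<open>Supremum norm and its metric\<close>

lemma bdd_above_c0_space:
  assumes "f \<in> carrier (c0_space I)"
  shows "bdd_above (range (\<lambda>k. cmod (f k)))"
proof -
  from assms have "convergent f" by (auto simp: convergent_def)
  then have "Bseq f" by (rule convergent_imp_Bseq)
  then show ?thesis by (auto simp: Bseq_def bdd_above_def)
qed

text \<open>Norms are handled below through their upper bounds, so that the supremum itself need not
  be evaluated.\<close>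

lemma nrm_c0_space_le_iff:
  assumes "f \<in> carrier (c0_space I)"
  shows "nrm (c0_space I) f \<le> B \<longleftrightarrow> (\<forall>k. cmod (f k) \<le> B)"
  using bdd_above_c0_space[OF assms] by (simp add: c0_space_def cSUP_le_iff)

lemma cmod_le_nrm_c0_space:
  assumes "f \<in> carrier (c0_space I)"
  shows "cmod (f k) \<le> nrm (c0_space I) f"
  using nrm_c0_space_le_iff[OF assms, of "nrm (c0_space I) f"] by simp

lemma nrm_c0_space_nonneg:
  assumes "f \<in> carrier (c0_space I)"
  shows "0 \<le> nrm (c0_space I) f"
  using cmod_le_nrm_c0_space[OF assms, of 0] norm_ge_zero order_trans by blast

lemma complex_normed_space_c0_space: "complex_normed_space (c0_space I)"
proof (intro complex_normed_space.intro complex_normed_space_axioms.intro module_c0_space)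
  fix x y :: "nat \<Rightarrow> complex" and c
  assume x: "x \<in> carrier (c0_space I)"
  show "nrm (c0_space I) x = 0 \<longleftrightarrow> x = \<zero>\<^bsub>c0_space I\<^esub>"
  proof
    assume "nrm (c0_space I) x = 0"
    then show "x = \<zero>\<^bsub>c0_space I\<^esub>"
      using cmod_le_nrm_c0_space[OF x] by (auto simp: fun_eq_iff)
  qed (simp add: c0_space_def)
  have cx: "c \<odot>\<^bsub>c0_space I\<^esub> x \<in> carrier (c0_space I)"
    using x by (auto intro: tendsto_eq_intros)
  show "nrm (c0_space I) (c \<odot>\<^bsub>c0_space I\<^esub> x) = cmod c * nrm (c0_space I) x"
  proof (cases "c = 0")
    case False
    \<comment> \<open>Two reals with the same upper bounds are equal.\<close>
    have "nrm (c0_space I) (c \<odot>\<^bsub>c0_space I\<^esub> x) \<le> B \<longleftrightarrow> cmod c * nrm (c0_space I) x \<le> B" for B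
    proof -
      have "cmod c * nrm (c0_space I) x \<le> B \<longleftrightarrow> nrm (c0_space I) x \<le> B / cmod c"
        using False by (simp add: field_simps)
      also have "\<dots> \<longleftrightarrow> (\<forall>k. cmod c * cmod (x k) \<le> B)"
        unfolding nrm_c0_space_le_iff[OF x] using False by (simp add: field_simps)
      finally show ?thesis
        unfolding nrm_c0_space_le_iff[OF cx] by (simp add: norm_mult)
    qed
    then show ?thesis by (meson order_antisym order_refl)
  qed (simp add: c0_space_def)
  assume y: "y \<in> carrier (c0_space I)"
  have "x \<oplus>\<^bsub>c0_space I\<^esub> y \<in> carrier (c0_space I)"
    using x y by (auto intro: tendsto_eq_intros)
  then show "nrm (c0_space I) (x \<oplus>\<^bsub>c0_space I\<^esub> y) \<le> nrm (c0_space I) x + nrm (c0_space I) y"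
    using norm_triangle_le[OF add_mono[OF cmod_le_nrm_c0_space[OF x] cmod_le_nrm_c0_space[OF y]]]
    by (subst nrm_c0_space_le_iff) simp_all
qed

lemma nrm_dist_c0_space_le_iff:
  assumes "f \<in> carrier (c0_space I)" "g \<in> carrier (c0_space I)"
  shows "nrm_dist (c0_space I) f g \<le> B \<longleftrightarrow> (\<forall>k. cmod (f k - g k) \<le> B)"
proof -
  have "(\<lambda>k. f k - g k) \<in> carrier (c0_space I)"
    using assms by (auto intro: tendsto_eq_intros)
  then show ?thesis
    using assms by (simp add: nrm_dist_def c0_space_minus nrm_c0_space_le_iff del: c0_space_sel(1))
qed

lemma cmod_diff_le_nrm_dist_c0_space:
  assumes "f \<in> carrier (c0_space I)" "g \<in> carrier (c0_space I)"
  shows "cmod (f k - g k) \<le> nrm_dist (c0_space I) f g"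
  using nrm_dist_c0_space_le_iff[OF assms] by blast

lemma Metric_space_c0_space: "Metric_space (carrier (c0_space I)) (nrm_dist (c0_space I))"
proof
  fix x y z :: "nat \<Rightarrow> complex"
  show "0 \<le> nrm_dist (c0_space I) x y"
  proof (cases "x \<in> carrier (c0_space I) \<and> y \<in> carrier (c0_space I)")
    case True
    then show ?thesis
      using cmod_diff_le_nrm_dist_c0_space[of x I y 0] norm_ge_zero order_trans by blast
  qed (auto simp: nrm_dist_def)
  show "nrm_dist (c0_space I) x y = nrm_dist (c0_space I) y x"
  proof (cases "x \<in> carrier (c0_space I) \<and> y \<in> carrier (c0_space I)")
    case True
    then show ?thesis
      by (intro order_antisym)
         (metis nrm_dist_c0_space_le_iff norm_minus_commute cmod_diff_le_nrm_dist_c0_space)+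
  qed (auto simp: nrm_dist_def)
  assume xy: "x \<in> carrier (c0_space I)" "y \<in> carrier (c0_space I)"
  have "nrm_dist (c0_space I) x y \<le> 0 \<longleftrightarrow> x = y"
    using xy by (auto simp: nrm_dist_c0_space_le_iff fun_eq_iff simp del: c0_space_sel(1))
  with \<open>0 \<le> nrm_dist (c0_space I) x y\<close>
  show "nrm_dist (c0_space I) x y = 0 \<longleftrightarrow> x = y" by auto
  assume z: "z \<in> carrier (c0_space I)"
  show "nrm_dist (c0_space I) x z \<le> nrm_dist (c0_space I) x y + nrm_dist (c0_space I) y z"
    unfolding nrm_dist_c0_space_le_iff[OF xy(1) z]
  proof
    fix k
    have "cmod (x k - z k) \<le> cmod (x k - y k) + cmod (y k - z k)"
      using norm_triangle_ineq[of "x k - y k" "y k - z k"] by simp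
    also have "\<dots> \<le> nrm_dist (c0_space I) x y + nrm_dist (c0_space I) y z"
      using cmod_diff_le_nrm_dist_c0_space[OF xy] cmod_diff_le_nrm_dist_c0_space[OF xy(2) z]
      by (rule add_mono)
    finally show "cmod (x k - z k) \<le> nrm_dist (c0_space I) x y + nrm_dist (c0_space I) y z" .
  qed
qed

section \<open>Completeness\<close>

interpretation c0: Metric_space "carrier (c0_space I)" "nrm_dist (c0_space I)"
  for I by (rule Metric_space_c0_space)

text \<open>Norm convergence is uniform convergence, and interchanging the limit in \<open>m\<close>
  with the limit in the coordinate shows that the uniform limit again tends to zero.\<close>

lemma c0_space_limI:
  assumes "\<And>m. \<sigma> m \<in> carrier (c0_space I)" and "uniform_limit UNIV \<sigma> f sequentially"
  shows "f \<in> carrier (c0_space I)" "limitin (nrm_topology (c0_space I)) \<sigma> f sequentially"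
proof -
  have "f \<longlonglongrightarrow> 0"
    by (rule swap_uniform_limit'[where f = \<sigma> and g = "\<lambda>_. 0" and F = sequentially and S = UNIV])
       (use assms in auto)
  moreover have "f k = 0" if "k \<notin> I" for k
  proof -
    have "(\<lambda>m. \<sigma> m k) \<longlonglongrightarrow> f k" using assms(2) by (rule tendsto_uniform_limitI) simp
    moreover have "(\<lambda>m. \<sigma> m k) = (\<lambda>_. 0)" using assms(1) that by auto
    ultimately show ?thesis by (simp add: LIMSEQ_const_iff)
  qed
  ultimately show f: "f \<in> carrier (c0_space I)" by simp
  show "limitin (nrm_topology (c0_space I)) \<sigma> f sequentially"
    unfolding nrm_topology_def c0.limitin_metric
  proof (intro conjI f allI impI)
    fix e :: real assume "0 < e"
    then have "\<forall>\<^sub>F m in sequentially. \<forall>k\<in>UNIV. dist (\<sigma> m k) (f k) < e / 2"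
      using uniform_limitD[OF assms(2), of "e / 2"] by simp
    then show "\<forall>\<^sub>F m in sequentially. \<sigma> m \<in> carrier (c0_space I) \<and> nrm_dist (c0_space I) (\<sigma> m) f < e"
    proof eventually_elim
      case (elim m)
      then have "nrm_dist (c0_space I) (\<sigma> m) f \<le> e / 2"
        unfolding nrm_dist_c0_space_le_iff[OF assms(1) f] by (auto simp: dist_norm intro: less_imp_le)
      with \<open>0 < e\<close> assms(1) show ?case by (simp del: c0_space_sel(1))
    qed
  qed
qed

lemma complex_banach_space_c0_space: "complex_banach_space (c0_space I)"
proof (intro complex_banach_space.intro complex_banach_space_axioms.intro
    complex_normed_space_c0_space)
  show "c0.mcomplete I"
    unfolding c0.mcomplete_def
  proof (intro allI impI)
    fix \<sigma> assume \<sigma>: "c0.MCauchy I \<sigma>"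
    then have car: "\<sigma> m \<in> carrier (c0_space I)" for m
      by (auto simp: c0.MCauchy_def simp del: c0_space_sel(1))
    have "uniformly_Cauchy_on UNIV \<sigma>"
    proof (rule uniformly_Cauchy_onI)
      fix e :: real assume "0 < e"
      with \<sigma> obtain N where N: "\<And>m n. N \<le> m \<Longrightarrow> N \<le> n \<Longrightarrow> nrm_dist (c0_space I) (\<sigma> m) (\<sigma> n) < e"
        unfolding c0.MCauchy_def by meson
      show "\<exists>M. \<forall>x\<in>UNIV. \<forall>m\<ge>M. \<forall>n\<ge>M. dist (\<sigma> m x) (\<sigma> n x) < e"
        unfolding dist_norm using N le_less_trans[OF cmod_diff_le_nrm_dist_c0_space[OF car car]]
        by (intro exI[of _ N]) blast
    qed
    then obtain f where "uniform_limit UNIV \<sigma> f sequentially"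
      using Cauchy_uniformly_convergent uniformly_convergent_on_def by blast
    then show "\<exists>x. limitin (c0.mtopology I) \<sigma> x sequentially"
      using c0_space_limI(2)[of \<sigma>, OF car] unfolding nrm_topology_def by blast
  qed
qed

section \<open>Separability\<close>

definition rat_seq :: "nat set \<Rightarrow> nat \<Rightarrow> nat \<Rightarrow> complex" where
  "rat_seq I l k = (let L = from_nat l :: (rat \<times> rat) list in
     if k < length L \<and> k \<in> I then Complex (of_rat (fst (L ! k))) (of_rat (snd (L ! k))) else 0)"

lemma finite_support_rat_seq: "finite {k. rat_seq I l k \<noteq> 0}"
  by (rule finite_subset[of _ "{..<length (from_nat l :: (rat \<times> rat) list)}"])
     (auto simp: rat_seq_def Let_def split: if_splits)

lemma rat_seq_in_c0_space: "rat_seq I l \<in> carrier (c0_space I)"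
proof -
  have "\<forall>\<^sub>F k in sequentially. rat_seq I l k = 0"
    using finite_support_rat_seq[of I l] by (simp flip: cofinite_eq_sequentially add: eventually_cofinite)
  then have "rat_seq I l \<longlonglongrightarrow> 0" by (rule tendsto_eventually)
  then show ?thesis by (simp add: rat_seq_def)
qed

text \<open>A long initial segment is rounded to rational real and imaginary parts; the tail is
  already small.\<close>

lemma rat_seq_dense:
  assumes "f \<in> carrier (c0_space I)" "0 < e"
  obtains l where "nrm_dist (c0_space I) f (rat_seq I l) < e"
proof -
  have rat: "\<exists>p :: rat \<times> rat. cmod (z - Complex (of_rat (fst p)) (of_rat (snd p))) \<le> e / 2" for z
  proof -
    obtain u v where u: "Re z - e / 4 < of_rat u" "of_rat u < Re z + e / 4"
      and v: "Im z - e / 4 < of_rat v" "of_rat v < Im z + e / 4"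
      using of_rat_dense[of "Re z - e / 4" "Re z + e / 4"] of_rat_dense[of "Im z - e / 4" "Im z + e / 4"]
        assms(2) by auto
    have "cmod (z - Complex (of_rat u) (of_rat v)) \<le> \<bar>Re z - of_rat u\<bar> + \<bar>Im z - of_rat v\<bar>"
      using cmod_le[of "z - Complex (of_rat u) (of_rat v)"] by simp
    with u v show ?thesis by (intro exI[of _ "(u, v)"]) auto
  qed
  then obtain p :: "complex \<Rightarrow> rat \<times> rat" where
    p: "\<And>z. cmod (z - Complex (of_rat (fst (p z))) (of_rat (snd (p z)))) \<le> e / 2" by metis
  have "\<forall>\<^sub>F k in sequentially. dist (f k) 0 < e / 2"
    using assms by (intro tendstoD) auto
  then obtain N where N: "\<And>k. N \<le> k \<Longrightarrow> cmod (f k) < e / 2"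
    by (auto simp: eventually_sequentially)
  define L where "L = map (\<lambda>k. p (f k)) [0..<N]"
  have "nrm_dist (c0_space I) f (rat_seq I (to_nat L)) \<le> e / 2"
    unfolding nrm_dist_c0_space_le_iff[OF assms(1) rat_seq_in_c0_space]
  proof
    fix k
    consider "k \<in> I" "k < N" | "k \<notin> I" | "N \<le> k" by linarith
    then show "cmod (f k - rat_seq I (to_nat L) k) \<le> e / 2"
    proof cases
      case 1
      then show ?thesis using p by (simp add: rat_seq_def L_def Let_def del: le_divide_eq_numeral1)
    next
      case 2
      with assms show ?thesis by (simp add: rat_seq_def)
    next
      case 3
      with N[of k] show ?thesis by (simp add: rat_seq_def L_def Let_def)
    qed
  qed
  with assms(2) show ?thesis by (intro that[of "to_nat L"]) auto
qed

lemma separable_c0_space: "separable_space (nrm_topology (c0_space I))"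
  unfolding separable_space_def
proof (intro exI conjI)
  show "range (rat_seq I) \<subseteq> topspace (nrm_topology (c0_space I))"
    using rat_seq_in_c0_space by (auto simp: nrm_topology_def simp del: c0_space_sel(1))
  show "nrm_topology (c0_space I) closure_of range (rat_seq I) = topspace (nrm_topology (c0_space I))"
    unfolding nrm_topology_def c0.metric_closure_of c0.topspace_mtopology
  proof (intro equalityI subsetI CollectI conjI allI impI)
    fix f and e :: real assume "f \<in> carrier (c0_space I)" "0 < e"
    then show "\<exists>y\<in>range (rat_seq I). y \<in> c0.mball I f e"
      using rat_seq_dense[of f I e] rat_seq_in_c0_space by (metis c0.in_mball rangeI)
  qed auto
qed simp

section \<open>Infinite dimension\<close>

lemma c0_space_finsum:
  assumes "finite S" "S \<subseteq> carrier (c0_space I)"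
  shows "(\<Oplus>\<^bsub>c0_space I\<^esub>s\<in>S. c s \<odot>\<^bsub>c0_space I\<^esub> s) k = (\<Sum>s\<in>S. c s * s k)"
  using assms
proof (induction S rule: finite_induct)
  case empty
  interpret abelian_group "c0_space I" by (rule abelian_group_c0_space)
  show ?case by simp
next
  case (insert s S)
  interpret abelian_group "c0_space I" by (rule abelian_group_c0_space)
  have sm: "c t \<odot>\<^bsub>c0_space I\<^esub> t \<in> carrier (c0_space I)" if "t \<in> insert s S" for t
    using insert.prems that by (auto intro!: tendsto_eq_intros)
  have "(\<Oplus>\<^bsub>c0_space I\<^esub>t\<in>insert s S. c t \<odot>\<^bsub>c0_space I\<^esub> t)
      = c s \<odot>\<^bsub>c0_space I\<^esub> s \<oplus>\<^bsub>c0_space I\<^esub> (\<Oplus>\<^bsub>c0_space I\<^esub>t\<in>S. c t \<odot>\<^bsub>c0_space I\<^esub> t)"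
    using sm insert.hyps by (intro finsum_insert) (auto simp del: c0_space_sel)
  with insert show ?case by simp
qed

text \<open>The unit vectors indexed by \<open>I\<close> are independent in the vector space of all
  sequences, where a finite spanning set would bound their number.\<close>

lemma infinite_dimensional_c0_space:
  assumes "infinite I"
  shows "infinite_dimensional (c0_space I)"
  unfolding infinite_dimensional_def
proof
  interpret V: vector_space "\<lambda>(c::complex) f (k::nat). c * f k"
    by unfold_locales (auto simp: algebra_simps)
  define \<delta> where "\<delta> i = (\<lambda>k. if k = i then 1 else 0 :: complex)" for i :: nat
  have \<delta>: "\<delta> i \<in> carrier (c0_space I)" if "i \<in> I" for i
  proof -
    have "\<forall>\<^sub>F k in sequentially. \<delta> i k = 0"
      by (auto simp: \<delta>_def eventually_sequentially intro: exI[of _ "Suc i"])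
    then have "\<delta> i \<longlonglongrightarrow> 0" by (rule tendsto_eventually)
    with that show ?thesis by (auto simp: \<delta>_def)
  qed
  have inj: "inj \<delta>" by (rule injI) (metis \<delta>_def zero_neq_one)
  have ev: "(\<Sum>f\<in>S. g f) k = (\<Sum>f\<in>S. g f k)" for S :: "(nat \<Rightarrow> complex) set" and g :: "_ \<Rightarrow> nat \<Rightarrow> complex" and k
    by (induction S rule: infinite_finite_induct) auto
  have indep: "V.independent (\<delta> ` I)"
    unfolding V.independent_explicit_finite_subsets
  proof (intro allI impI ballI)
    fix S u v assume S: "S \<subseteq> \<delta> ` I" "finite S" "(\<Sum>v\<in>S. (\<lambda>k. u v * v k)) = 0" "v \<in> S"
    then obtain i where i: "v = \<delta> i" by auto
    have "0 = (\<Sum>w\<in>S. u w * w i)" using fun_cong[OF S(3), of i] by (simp add: ev)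
    also have "\<dots> = (\<Sum>w\<in>S. if w = v then u v else 0)"
    proof (rule sum.cong[OF refl])
      fix w assume "w \<in> S"
      with S(1) obtain j where "w = \<delta> j" by auto
      then show "u w * w i = (if w = v then u v else 0)"
        using inj_eq[OF inj, of j i] by (cases "j = i") (simp_all add: i, simp_all add: \<delta>_def)
    qed
    also have "\<dots> = u v" using S by simp
    finally show "u v = 0" by simp
  qed
  assume "\<exists>S. finite S \<and> S \<subseteq> carrier (c0_space I) \<and>
    (\<forall>x\<in>carrier (c0_space I). \<exists>c. x = (\<Oplus>\<^bsub>c0_space I\<^esub>s\<in>S. c s \<odot>\<^bsub>c0_space I\<^esub> s))"
  then obtain S where S: "finite S" "S \<subseteq> carrier (c0_space I)"
    "\<And>x. x \<in> carrier (c0_space I) \<Longrightarrow> \<exists>c. x = (\<Oplus>\<^bsub>c0_space I\<^esub>s\<in>S. c s \<odot>\<^bsub>c0_space I\<^esub> s)"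
    by blast
  have "\<delta> ` I \<subseteq> V.span S"
  proof clarify
    fix i assume "i \<in> I"
    then obtain c where c: "\<delta> i = (\<Oplus>\<^bsub>c0_space I\<^esub>s\<in>S. c s \<odot>\<^bsub>c0_space I\<^esub> s)"
      using S(3) \<delta> by blast
    have "\<delta> i = (\<Sum>s\<in>S. (\<lambda>k. c s * s k))"
      by (rule ext) (simp only: c c0_space_finsum[OF S(1,2)] ev)
    then show "\<delta> i \<in> V.span S"
      by (simp add: V.span_sum V.span_scale V.span_base)
  qed
  then have "finite (\<delta> ` I)" using V.independent_span_bound[OF S(1) indep] by blast
  with assms show False using inj by (simp add: finite_image_iff inj_on_subset)
qed

subsection \<open>Separated sets of positive lower density\<close>

text \<open>The ruler sequence: each value \<open>j\<close> recurs along an arithmetic progression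
  of difference \<open>2 ^ Suc j\<close>, yet the averages stay at most \<open>1\<close>.\<close>

definition jump :: "nat \<Rightarrow> nat" where
  "jump i = multiplicity 2 (Suc i)"

lemma jump_double [simp]: "jump (2 * i) = 0"
  by (simp add: jump_def not_dvd_imp_multiplicity_0)

lemma jump_Suc_double [simp]: "jump (Suc (2 * i)) = Suc (jump i)"
  using multiplicity_times_same[where p = 2 and x = "Suc i"] by (simp add: jump_def)

lemma jump_le: "jump i \<le> i"
proof -
  have "jump i < 2 ^ jump i" by (rule less_exp)
  also have "\<dots> \<le> Suc i"
    unfolding jump_def by (rule dvd_imp_le[OF multiplicity_dvd]) simp
  finally show ?thesis by simp
qed

lemma sum_jump_double: "(\<Sum>k<2 * N. jump k) = N + (\<Sum>k<N. jump k)"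
  by (induction N) simp_all

text \<open>Even indices contribute nothing and odd ones repeat the sequence raised by one, so the
  sum over \<open>2 * M\<close> indices is \<open>M\<close> plus the sum over \<open>M\<close>
  indices.\<close>

lemma sum_jump_le: "(\<Sum>k<N. jump k) \<le> N"
proof (induction N rule: less_induct)
  case (less N)
  show ?case
  proof (cases "even N")
    case True
    then obtain M where M: "N = 2 * M" by (elim evenE)
    show ?thesis
    proof (cases "M = 0")
      case False
      with less.IH[of M] show ?thesis by (simp add: M sum_jump_double)
    qed (simp add: M)
  next
    case False
    then obtain M where M: "N = Suc (2 * M)" by (auto elim: oddE)
    with less.IH[of M] show ?thesis by (simp add: sum_jump_double)
  qed
qed

text \<open>The successor of the argument is \<open>2 ^ j\<close> times the odd number
  \<open>2 * t + 1\<close>.\<close>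

lemma jump_arith: "jump (2 ^ Suc j * t + (2 ^ j - 1)) = j"
proof (induction j)
  case (Suc j)
  obtain c :: nat where "2 ^ j = Suc c" by (metis gr0_implies_Suc zero_less_numeral zero_less_power)
  then have "2 ^ Suc (Suc j) * t + (2 ^ Suc j - 1) = Suc (2 * (2 ^ Suc j * t + (2 ^ j - 1)))"
    by (simp add: algebra_simps)
  with Suc show ?case by simp
qed simp

text \<open>
  The set of all \<open>centre i\<close> with \<open>jump i = j\<close> has positive lower density for every \<open>j\<close>, because
  the average of \<^const>\<open>jump\<close> is bounded; it has gaps of at least \<open>j + j'\<close> to the set for \<open>j'\<close>.
\<close>

definition centre :: "nat \<Rightarrow> nat" where
  "centre i = 2 * (\<Sum>k<i. Suc (jump k)) + Suc (jump i)"

text \<open>The centres are the midpoints of intervals of length \<open>2 * Suc (jump i)\<close>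
  laid end to end, so two of them are at least the sum of the half-lengths apart.\<close>

lemma centre_separated:
  assumes "i < i'"
  shows "centre i + jump i + jump i' + 2 \<le> centre i'"
proof -
  have "(\<Sum>k<Suc i. Suc (jump k)) \<le> (\<Sum>k<i'. Suc (jump k))"
    using assms by (intro sum_mono2) auto
  then show ?thesis by (simp add: centre_def)
qed

lemma centre_separated_abs:
  assumes "i \<noteq> i'"
  shows "int (jump i) + int (jump i') + 2 \<le> \<bar>int (centre i) - int (centre i')\<bar>"
  using assms centre_separated[of i i'] centre_separated[of i' i] by (cases "i < i'") auto

lemma strict_mono_centre: "strict_mono centre"
  by (rule strict_monoI) (use centre_separated in fastforce)

lemma centre_ge: "i + jump i < centre i"
proof -
  have "i \<le> (\<Sum>k<i. Suc (jump k))" using sum_mono[of "{..<i}" "\<lambda>_. 1" "\<lambda>k. Suc (jump k)"] by simp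
  then show ?thesis by (simp add: centre_def)
qed

text \<open>Because the centres grow linearly, progressions of indices yield sets of positive lower
  density.\<close>

lemma centre_le: "centre i \<le> 5 * i + 1"
proof -
  have "(\<Sum>k<i. Suc (jump k)) = i + (\<Sum>k<i. jump k)"
    by (simp add: sum.distrib flip: One_nat_def add: Suc_eq_plus1_left del: One_nat_def)
  then show ?thesis using sum_jump_le[of i] jump_le[of i] by (simp add: centre_def)
qed

lemma lower_density_pos:
  assumes "inj b" and b: "\<And>t. b t \<in> B" "\<And>t. 1 \<le> b t" "\<And>t. b t \<le> L * Suc t"
  shows "0 < lower_density B"
proof -
  have L: "0 < L" using b(2)[of 0] b(3)[of 0] by simp
  \<comment> \<open>At least \<open>N div L\<close> values of \<open>b\<close> are at most
    \<open>N\<close>; once \<open>N\<close> reaches \<open>2 * L\<close>, rounding down loses at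
    most half of \<open>N / L\<close>.\<close>
  have "1 / (2 * real L) \<le> real (card {n \<in> B. 1 \<le> n \<and> n \<le> N}) / real N" if N: "2 * L \<le> N" for N
  proof -
    have "b ` {..<N div L} \<subseteq> {n \<in> B. 1 \<le> n \<and> n \<le> N}"
    proof clarsimp
      fix t assume "t < N div L"
      then have "L * Suc t \<le> L * (N div L)" by (intro mult_le_mono2) simp
      also have "\<dots> \<le> N" by simp
      finally show "b t \<in> B \<and> Suc 0 \<le> b t \<and> b t \<le> N" using b(1,2)[of t] b(3)[of t] by simp
    qed
    then have "card (b ` {..<N div L}) \<le> card {n \<in> B. 1 \<le> n \<and> n \<le> N}"
      by (intro card_mono) (auto intro: finite_subset[of _ "{..N}"])
    then have c: "N div L \<le> card {n \<in> B. 1 \<le> n \<and> n \<le> N}"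
      using \<open>inj b\<close> by (simp add: card_image inj_on_subset)
    have "N < L * (N div L) + L" using L dividend_less_times_div[of L N] by (simp add: algebra_simps)
    with N have "N \<le> 2 * (L * (N div L))" by linarith
    also have "\<dots> \<le> 2 * (L * card {n \<in> B. 1 \<le> n \<and> n \<le> N})" using c by simp
    finally have "real N \<le> real (2 * (L * card {n \<in> B. 1 \<le> n \<and> n \<le> N}))" by (rule of_nat_mono)
    with L N show ?thesis by (simp add: field_simps)
  qed
  then have "\<forall>\<^sub>F N in sequentially.
      ereal (1 / (2 * real L)) \<le> ereal (real (card {n \<in> B. 1 \<le> n \<and> n \<le> N}) / real N)"
    by (auto simp: eventually_sequentially)
  then have "ereal (1 / (2 * real L)) \<le> lower_density B"
    unfolding lower_density_def by (rule Liminf_bounded)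
  moreover have "0 < ereal (1 / (2 * real L))" using L by simp
  ultimately show ?thesis by (rule less_le_trans[rotated])
qed

subsection \<open>Weighted shifts\<close>

text \<open>All norms in a small ball around \<open>u\<close> are nearly equal, whereas every
  positive power of \<open>T\<close> changes norms by a factor of at least
  \<open>1 / \<rho>\<close>, always in the same direction.\<close>

lemma not_recurrent_c0_space:
  assumes T: "\<And>f. f \<in> carrier (c0_space I) \<Longrightarrow> T f \<in> carrier (c0_space I)"
    and \<rho>: "0 < \<rho>" "\<rho> < 1"
    and "(\<forall>f\<in>carrier (c0_space I). nrm (c0_space I) (T f) \<le> \<rho> * nrm (c0_space I) f) \<or>
         (\<forall>f\<in>carrier (c0_space I). nrm (c0_space I) f \<le> \<rho> * nrm (c0_space I) (T f))"
    and u: "u \<in> carrier (c0_space I)" "nrm (c0_space I) u \<noteq> 0"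
  shows "\<not> recurrent_operator (c0_space I) T"
proof
  let ?n = "nrm (c0_space I)"
  assume rec: "recurrent_operator (c0_space I) T"
  define a where "a = ?n u"
  \<comment> \<open>This radius solves \<open>\<rho> * (a + \<delta>) = a - \<delta>\<close>, so two
    norms strictly within it of \<open>a\<close> are never related by the factor
    \<open>\<rho>\<close>.\<close>
  define \<delta> where "\<delta> = a * (1 - \<rho>) / (1 + \<rho>)"
  have a: "0 < a" using u nrm_c0_space_nonneg[OF u(1)] by (simp add: a_def)
  then have \<delta>: "0 < \<delta>" "\<rho> * (a + \<delta>) = a - \<delta>" using \<rho> by (simp_all add: \<delta>_def field_simps)
  have Tk: "(T ^^ k) f \<in> carrier (c0_space I)" if "f \<in> carrier (c0_space I)" for f k
    using that T by (induction k) (auto simp del: c0_space_sel)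
  have near: "\<bar>?n f - a\<bar> < \<delta>" if "f \<in> c0.mball I u \<delta>" for f
  proof -
    have f: "f \<in> carrier (c0_space I)" and d: "nrm_dist (c0_space I) u f < \<delta>"
      using that by (auto simp del: c0_space_sel)
    have *: "?n g \<le> ?n h + nrm_dist (c0_space I) g h"
      if "g \<in> carrier (c0_space I)" "h \<in> carrier (c0_space I)" for g h
      unfolding nrm_c0_space_le_iff[OF that(1)]
    proof
      fix k
      have "cmod (g k) \<le> cmod (h k) + cmod (g k - h k)" by (metis add_diff_cancel_left' diff_add_cancel norm_triangle_ineq add.commute)
      also have "\<dots> \<le> ?n h + nrm_dist (c0_space I) g h"
        using that by (intro add_mono cmod_le_nrm_c0_space cmod_diff_le_nrm_dist_c0_space)
      finally show "cmod (g k) \<le> ?n h + nrm_dist (c0_space I) g h" .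
    qed
    show ?thesis
      using *[OF f u(1)] *[OF u(1) f] d c0.commute[of I u f] by (simp add: a_def abs_if)
  qed
  have "openin (nrm_topology (c0_space I)) (c0.mball I u \<delta>)" "c0.mball I u \<delta> \<noteq> {}"
    using u \<delta> by (auto simp: nrm_topology_def c0.mball_eq_empty simp del: c0_space_sel)
  then obtain k f where k: "1 \<le> k" and f: "f \<in> c0.mball I u \<delta>" "(T ^^ k) f \<in> c0.mball I u \<delta>"
    using rec unfolding recurrent_operator_def by blast
  from f have fc: "f \<in> carrier (c0_space I)" by (simp del: c0_space_sel)
  have "?n ((T ^^ k) f) \<le> \<rho> * ?n f \<or> ?n f \<le> \<rho> * ?n ((T ^^ k) f)"
    using assms(4)
  proof
    \<comment> \<open>One factor \<open>\<rho>\<close> is enough; the remaining applications are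
      only used not to increase the norm.\<close>
    assume c: "\<forall>f\<in>carrier (c0_space I). ?n (T f) \<le> \<rho> * ?n f"
    from k have "?n ((T ^^ k) f) \<le> \<rho> * ?n f"
    proof (induction k rule: nat_induct_at_least)
      case base
      with c fc show ?case by (simp del: c0_space_sel)
    next
      case (Suc k)
      have "?n ((T ^^ Suc k) f) \<le> \<rho> * ?n ((T ^^ k) f)" using c Tk[OF fc] by simp
      also have "\<dots> \<le> 1 * ?n ((T ^^ k) f)"
        using \<rho> nrm_c0_space_nonneg[OF Tk[OF fc]] by (intro mult_right_mono) auto
      finally show ?case using Suc by simp
    qed
    then show ?thesis ..
  next
    assume c: "\<forall>f\<in>carrier (c0_space I). ?n f \<le> \<rho> * ?n (T f)"
    from k have "?n f \<le> \<rho> * ?n ((T ^^ k) f)"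
    proof (induction k rule: nat_induct_at_least)
      case base
      with c fc show ?case by (simp del: c0_space_sel)
    next
      case (Suc k)
      have "?n ((T ^^ k) f) \<le> \<rho> * ?n ((T ^^ Suc k) f)" using c Tk[OF fc] by simp
      also have "\<dots> \<le> 1 * ?n ((T ^^ Suc k) f)"
        using \<rho> nrm_c0_space_nonneg[OF Tk[OF fc]] by (intro mult_right_mono) (auto simp del: funpow.simps)
      finally have "\<rho> * ?n ((T ^^ k) f) \<le> \<rho> * ?n ((T ^^ Suc k) f)"
        using \<rho> by (intro mult_left_mono) auto
      with Suc show ?case by simp
    qed
    then show ?thesis ..
  qed
  moreover have "\<rho> * ?n g < a - \<delta>" if "g \<in> c0.mball I u \<delta>" for g
    using near[OF that] \<rho> \<delta>(2) mult_strict_left_mono[of "?n g" "a + \<delta>" \<rho>] by (simp add: abs_less_iff)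
  ultimately show False
    using near[OF f(1)] near[OF f(2)] f by (fastforce simp: abs_less_iff simp del: c0.in_mball)
qed

text \<open>\<open>\<mu>\<close> provides the scalars. When \<open>n\<close> grows by one,
  \<open>\<mu>_forward\<close> shrinks the right inverse of the scaled power on nonnegative
  coordinates by \<open>q\<close>, and \<open>\<mu>_backward\<close> shrinks the scaled power itself
  by \<open>q\<close> on negative ones. Normalising \<open>\<mu> 0\<close> makes the unshifted
  vector the case of index \<open>0\<close>.\<close>

locale weighted_shift =
  fixes \<alpha> \<beta> q :: real and \<mu> :: "nat \<Rightarrow> real"
  assumes \<alpha>: "0 < \<alpha>" and \<beta>: "0 \<le> \<beta>" and q: "0 < q" "q < 1"
    and \<mu>_0: "\<mu> 0 = 1" and \<mu>_pos: "0 < \<mu> n"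
    and \<mu>_forward: "\<mu> n \<le> q * \<alpha> * \<mu> (Suc n)"
    and \<mu>_backward: "\<beta> * \<mu> (Suc n) \<le> q * \<mu> n"
begin

text \<open>
  The shift moves coordinates to the left. It has weight \<open>\<alpha>\<close> on the nonnegative and \<open>\<beta>\<close> on the
  negative integers, encoded by \<^const>\<open>int_encode\<close>. As the weight at \<open>k\<close> is \<open>\<omega> k / \<omega> (k + 1)\<close>, its
  powers telescope. For \<open>\<beta> = 0\<close> the support of \<open>\<omega>\<close> is the set of nonnegative integers and the
  shift is unilateral.
\<close>

definition weight :: "int \<Rightarrow> real" where
  "weight k = (if 0 \<le> k then \<alpha> else \<beta>)"

definition \<omega> :: "int \<Rightarrow> real" where
  "\<omega> k = (if 0 \<le> k then (1 / \<alpha>) ^ nat k else \<beta> ^ nat (- k))"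

definition shift :: "(nat \<Rightarrow> complex) \<Rightarrow> nat \<Rightarrow> complex" where
  "shift f n = complex_of_real (weight (int_decode n)) * f (int_encode (int_decode n + 1))"

definition supp :: "nat set" where
  "supp = {n. \<omega> (int_decode n) \<noteq> 0}"

abbreviation X :: "(nat \<Rightarrow> complex) normed_module" where
  "X \<equiv> c0_space supp"

lemma \<omega>_nonneg: "0 \<le> \<omega> k"
  using \<alpha> \<beta> by (simp add: \<omega>_def)

lemma weight_nonneg: "0 \<le> weight k"
  using \<alpha> \<beta> by (simp add: weight_def)

lemma weight_\<omega>: "weight k * \<omega> (k + 1) = \<omega> k"
proof (cases "0 \<le> k")
  case True
  then have "nat (k + 1) = Suc (nat k)" by simp
  with True \<alpha> show ?thesis by (simp add: weight_def \<omega>_def)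
next
  case False
  then have "nat (- k) = Suc (nat (- (k + 1)))" by simp
  moreover have "0 \<le> k + 1 \<Longrightarrow> k = - 1" using False by simp
  ultimately show ?thesis using False by (auto simp: weight_def \<omega>_def)
qed

lemma \<omega>_add_nonzero: "\<omega> k \<noteq> 0 \<Longrightarrow> \<omega> (k + int n) \<noteq> 0"
proof (induction n)
  case (Suc n)
  then show ?case using weight_\<omega>[of "k + int n"] by (auto simp: algebra_simps)
qed simp

lemma encode_in_supp: "int_encode k \<in> supp \<longleftrightarrow> \<omega> k \<noteq> 0"
  by (simp add: supp_def)

lemma infinite_supp: "infinite supp"
proof -
  have "(\<lambda>n. int_encode (int n)) ` UNIV \<subseteq> supp"
    using \<alpha> by (auto simp: encode_in_supp \<omega>_def)
  moreover have "inj (\<lambda>n. int_encode (int n))" by (simp add: inj_def int_encode_eq)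
  ultimately show ?thesis using infinite_super range_inj_infinite by blast
qed

lemma shift_closed:
  assumes "f \<in> carrier X"
  shows "shift f \<in> carrier X"
proof -
  let ?h = "\<lambda>n. int_encode (int_decode n + 1)"
  have "inj ?h" by (simp add: inj_def int_encode_eq int_decode_eq)
  \<comment> \<open>Preimages of finite sets under an injective map are finite, so the map tends to
    infinity.\<close>
  then have "filterlim ?h sequentially sequentially"
    unfolding filterlim_iff cofinite_eq_sequentially[symmetric] eventually_cofinite
    using finite_vimageI by (fastforce simp: vimage_def)
  with assms have "(\<lambda>n. f (?h n)) \<longlonglongrightarrow> 0" by (auto intro: filterlim_compose)
  then have "(\<lambda>n. complex_of_real (max \<alpha> \<beta>) * f (?h n)) \<longlonglongrightarrow> 0" by (rule tendsto_mult_right_zero)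
  then have "shift f \<longlonglongrightarrow> 0"
    by (rule Lim_transform_bound[rotated])
       (use \<alpha> \<beta> in \<open>auto simp: shift_def weight_def norm_mult intro!: always_eventually mult_right_mono\<close>)
  moreover have "shift f n = 0" if "n \<notin> supp" for n
  proof -
    have "weight (int_decode n) * \<omega> (int_decode n + 1) = 0"
      using that weight_\<omega>[of "int_decode n"] by (simp add: supp_def)
    then have "weight (int_decode n) = 0 \<or> ?h n \<notin> supp" by (simp add: encode_in_supp)
    with assms show ?thesis by (auto simp: shift_def)
  qed
  ultimately show ?thesis by simp
qed

lemma funpow_shift_closed: "f \<in> carrier X \<Longrightarrow> (shift ^^ n) f \<in> carrier X"
  by (induction n) (auto simp: shift_closed simp del: c0_space_sel)

lemma funpow_shift:
  assumes "f \<in> carrier X"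
  shows "(shift ^^ n) f (int_encode k)
    = complex_of_real (\<omega> k / \<omega> (k + int n)) * f (int_encode (k + int n))"
proof (induction n arbitrary: k)
  case 0
  \<comment> \<open>Where \<open>\<omega> k\<close> is \<open>0\<close> the quotient is
    \<open>0\<close> rather than \<open>1\<close>, but \<open>f\<close> vanishes there too.\<close>
  show ?case using assms encode_in_supp[of k] by (cases "\<omega> k = 0") auto
next
  case (Suc n)
  have "weight k * (\<omega> (k + 1) / \<omega> (k + 1 + int n)) = \<omega> k / \<omega> (k + int (Suc n))"
    using weight_\<omega>[of k] by (simp add: algebra_simps)
  moreover have "(shift ^^ Suc n) f (int_encode k)
      = complex_of_real (weight k) * (shift ^^ n) f (int_encode (k + 1))"
    by (simp add: shift_def)
  ultimately show ?case
    by (simp only: Suc.IH flip: mult.assoc of_real_mult) (simp add: algebra_simps)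
qed

lemma bounded_linear_operator_shift: "bounded_linear_operator X shift"
  unfolding bounded_linear_operator_def
proof (intro conjI ballI allI exI)
  fix f assume f: "f \<in> carrier X"
  show "shift f \<in> carrier X" by (rule shift_closed[OF f])
  show "nrm X (shift f) \<le> max \<alpha> \<beta> * nrm X f"
    unfolding nrm_c0_space_le_iff[OF shift_closed[OF f]]
    using cmod_le_nrm_c0_space[OF f] \<alpha> \<beta>
    by (auto simp: shift_def weight_def norm_mult intro!: mult_mono)
qed (auto simp: shift_def algebra_simps)

text \<open>With weights below \<open>1\<close>, including \<open>\<beta> = 0\<close>, the shift
  contracts. With weights above \<open>1\<close> it expands, since each coordinate of
  \<open>f\<close> reappears enlarged one place to the left.\<close>

lemma not_recurrent_shift:
  assumes "\<alpha> < 1 \<and> \<beta> < 1 \<or> 1 < \<alpha> \<and> 1 < \<beta>"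
  shows "\<not> recurrent_operator X shift"
proof -
  define u where "u n = (if n = int_encode 0 then 1 else 0 :: complex)" for n
  have "\<forall>\<^sub>F n in sequentially. u n = 0"
    by (auto simp: u_def eventually_sequentially intro: exI[of _ "Suc (int_encode 0)"])
  then have "u \<longlonglongrightarrow> 0" by (rule tendsto_eventually)
  then have u: "u \<in> carrier X" by (auto simp: u_def encode_in_supp \<omega>_def)
  have u0: "nrm X u \<noteq> 0" using cmod_le_nrm_c0_space[OF u, of "int_encode 0"] by (auto simp: u_def)
  from assms show ?thesis
  proof
    assume less: "\<alpha> < 1 \<and> \<beta> < 1"
    have "nrm X (shift f) \<le> max \<alpha> \<beta> * nrm X f" if f: "f \<in> carrier X" for f
      unfolding nrm_c0_space_le_iff[OF shift_closed[OF f]]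
      using cmod_le_nrm_c0_space[OF f] \<alpha> \<beta>
      by (auto simp: shift_def weight_def norm_mult intro!: mult_mono)
    with less \<alpha> u u0 show ?thesis
      by (intro not_recurrent_c0_space[of supp shift "max \<alpha> \<beta>" u] shift_closed) auto
  next
    assume greater: "1 < \<alpha> \<and> 1 < \<beta>"
    have "nrm X f \<le> inverse (min \<alpha> \<beta>) * nrm X (shift f)" if f: "f \<in> carrier X" for f
      unfolding nrm_c0_space_le_iff[OF f]
    proof
      fix n
      let ?k = "int_decode n - 1"
      have "min \<alpha> \<beta> * cmod (f n) \<le> weight ?k * cmod (f n)"
        by (intro mult_right_mono) (auto simp: weight_def)
      also have "\<dots> = cmod (shift f (int_encode ?k))"
        using weight_nonneg by (simp add: shift_def norm_mult)
      also have "\<dots> \<le> nrm X (shift f)" by (rule cmod_le_nrm_c0_space[OF shift_closed[OF f]])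
      finally show "cmod (f n) \<le> inverse (min \<alpha> \<beta>) * nrm X (shift f)"
        using greater by (simp add: field_simps)
    qed
    with greater u u0 show ?thesis
      by (intro not_recurrent_c0_space[of supp shift "inverse (min \<alpha> \<beta>)" u] shift_closed)
         (auto simp: inverse_less_1_iff)
  qed
qed

text \<open>
  Where \<open>\<omega>\<close> does not vanish, \<open>gain m n s\<close> is the factor by which \<open>\<mu> m\<close> times the \<open>m\<close>-th power of
  the shift, applied after the right inverse of \<open>\<mu> n\<close> times the \<open>n\<close>-th power, multiplies the
  coordinate \<open>s\<close>.
\<close>

definition gain :: "nat \<Rightarrow> nat \<Rightarrow> int \<Rightarrow> real" where
  "gain m n s = \<mu> m / \<mu> n * (\<omega> (int n - int m + s) / \<omega> s)"

lemma gain_nonneg: "0 \<le> gain m n s"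
  using \<mu>_pos[of m] \<mu>_pos[of n] \<omega>_nonneg by (simp add: gain_def)

lemma \<mu>_forward_power: "\<mu> m \<le> (q * \<alpha>) ^ d * \<mu> (m + d)"
proof (induction d)
  case (Suc d)
  have "(q * \<alpha>) ^ d * \<mu> (m + d) \<le> (q * \<alpha>) ^ d * (q * \<alpha> * \<mu> (Suc (m + d)))"
    using q \<alpha> by (intro mult_left_mono \<mu>_forward) simp
  with Suc show ?case by (simp add: algebra_simps)
qed simp

lemma \<mu>_backward_power: "\<beta> ^ d * \<mu> (n + d) \<le> q ^ d * \<mu> n"
proof (induction d)
  case (Suc d)
  have "\<beta> ^ d * (\<beta> * \<mu> (Suc (n + d))) \<le> \<beta> ^ d * (q * \<mu> (n + d))"
    using \<beta> by (intro mult_left_mono \<mu>_backward) simp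
  also have "\<dots> = q * (\<beta> ^ d * \<mu> (n + d))" by simp
  also have "\<dots> \<le> q * (q ^ d * \<mu> n)" using Suc q by (intro mult_left_mono) auto
  finally show ?case by (simp add: algebra_simps)
qed simp

text \<open>
  Without the restriction on \<open>n - m\<close> this fails if \<open>\<beta> = 0\<close> and \<open>\<mu>\<close> grows faster than
  exponentially; with it, a shift by \<open>m - n\<close> moves the coordinate \<open>s\<close> across the origin.
\<close>
lemma gain_bound:
  assumes s: "\<omega> s \<noteq> 0"
  obtains M where "\<And>m n. \<bar>s\<bar> < \<bar>int n - int m\<bar> \<Longrightarrow> gain m n s \<le> M * q ^ nat \<bar>int n - int m\<bar>"
proof -
  \<comment> \<open>These stand for the powers of \<open>\<alpha>\<close> and \<open>\<beta>\<close>
    with exponent \<open>- s\<close>, which compare \<open>\<omega>\<close> at a coordinate moved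
    past the origin with the weight power for the distance. Splitting the exponent into natural
    parts admits \<open>\<beta> = 0\<close>.\<close>
  define A where "A = (1 / \<alpha>) ^ nat s * \<alpha> ^ nat (- s)"
  define B where "B = (1 / \<beta>) ^ nat s * \<beta> ^ nat (- s)"
  have AB: "0 \<le> A" "0 \<le> B" using \<alpha> \<beta> by (simp_all add: A_def B_def)
  have ws: "0 < \<omega> s" using s \<omega>_nonneg[of s] by simp
  have A: "\<alpha> ^ d * \<omega> (int d + s) = A" if "\<bar>s\<bar> < int d" for d
  proof (cases "0 \<le> s")
    case True
    then have "nat (int d + s) = d + nat s" by (simp add: nat_add_distrib)
    with True \<alpha> show ?thesis by (simp add: \<omega>_def A_def power_add power_divide)
  next
    case False
    define r where "r = nat (- s)"
    with False that have "nat (int d + s) = d - r" "r < d" by auto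
    moreover from this have "\<alpha> ^ d = \<alpha> ^ r * \<alpha> ^ (d - r)" by (simp flip: power_add)
    ultimately show ?thesis using False that \<alpha>
      by (simp add: \<omega>_def A_def power_divide flip: r_def)
  qed
  have B: "\<omega> (s - int d) \<le> \<beta> ^ d * B" if "\<bar>s\<bar> < int d" for d
  proof (cases "0 \<le> s")
    case True
    define r where "r = nat s"
    with True that have d: "nat (int d - s) = d - r" "r < d" by auto
    then have "\<beta> ^ d = \<beta> ^ r * \<beta> ^ (d - r)" by (simp flip: power_add)
    moreover have "\<omega> (s - int d) = \<beta> ^ (d - r)" using d that True by (simp add: \<omega>_def)
    moreover have "B = (1 / \<beta>) ^ r" using True by (simp add: B_def r_def)
    \<comment> \<open>Strictness matters for \<open>\<beta> = 0\<close>, where the left side must be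
      \<open>0\<close> and not the zeroth power.\<close>
    moreover have "0 < d - r" using d by simp
    ultimately show ?thesis
      using \<beta> by (cases "\<beta> = 0") (simp_all add: power_divide power_0_left)
  next
    case False
    then have "nat (int d - s) = d + nat (- s)" by simp
    with False that show ?thesis by (simp add: \<omega>_def B_def power_add)
  qed
  have "gain m n s \<le> (A + B) / \<omega> s * q ^ nat \<bar>int n - int m\<bar>" if mn: "\<bar>s\<bar> < \<bar>int n - int m\<bar>" for m n
  proof (cases "m \<le> n")
    case True
    define d where "d = n - m"
    with True have n: "n = m + d" by simp
    have "\<mu> m * \<omega> (int d + s) \<le> (q * \<alpha>) ^ d * \<mu> n * \<omega> (int d + s)"
      unfolding n by (intro mult_right_mono \<mu>_forward_power \<omega>_nonneg)
    also have "\<dots> = q ^ d * \<mu> n * (\<alpha> ^ d * \<omega> (int d + s))" by (simp add: power_mult_distrib)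
    also have "\<dots> = q ^ d * \<mu> n * A" using A[of d] mn n by simp
    also have "\<dots> \<le> q ^ d * \<mu> n * (A + B)" using q \<mu>_pos[of n] AB by (intro mult_left_mono) auto
    finally show ?thesis using ws \<mu>_pos[of n] n by (simp add: gain_def field_simps)
  next
    case False
    define d where "d = m - n"
    with False have m: "m = n + d" by simp
    have "\<mu> m * \<omega> (s - int d) \<le> \<mu> m * (\<beta> ^ d * B)"
      using \<mu>_pos[of m] mn m by (intro mult_left_mono B) auto
    also have "\<dots> = (\<beta> ^ d * \<mu> (n + d)) * B" by (simp add: m)
    also have "\<dots> \<le> (q ^ d * \<mu> n) * B" using AB by (intro mult_right_mono \<mu>_backward_power)
    also have "\<dots> \<le> (q ^ d * \<mu> n) * (A + B)" using q \<mu>_pos[of n] AB by (intro mult_left_mono) auto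
    finally show ?thesis using ws \<mu>_pos[of n] m by (simp add: gain_def field_simps)
  qed
  then show ?thesis by (rule that)
qed

text \<open>
  The factor \<open>q ^ j\<close> absorbs the size of \<open>y\<close>, so that blocks at distance at least the sum of
  their indices disturb each other by at most \<open>q ^ j\<close>, uniformly in the other block.
\<close>

definition tame :: "(nat \<Rightarrow> complex) \<Rightarrow> nat \<Rightarrow> bool" where
  "tame y j \<longleftrightarrow> (\<forall>s. int j < \<bar>s\<bar> \<longrightarrow> y (int_encode s) = 0) \<and>
     (\<forall>s m n. \<bar>s\<bar> < \<bar>int n - int m\<bar> \<longrightarrow>
        gain m n s * cmod (y (int_encode s)) * q ^ j \<le> q ^ nat \<bar>int n - int m\<bar>)"

text \<open>Only finitely many coordinates matter, and for each of them \<open>q ^ j\<close>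
  eventually beats the constant from \<open>gain_bound\<close>.\<close>

lemma eventually_tame:
  assumes y: "y \<in> carrier X" "finite {n. y n \<noteq> 0}"
  shows "\<forall>\<^sub>F j in sequentially. tame y j"
proof -
  define S where "S = {s. y (int_encode s) \<noteq> 0}"
  have S: "finite S"
    using finite_vimageI[OF y(2) inj_int_encode] by (simp add: S_def vimage_def)
  have "\<forall>\<^sub>F j in sequentially. \<forall>s\<in>S. \<bar>s\<bar> \<le> int j \<and>
      (\<forall>m n. \<bar>s\<bar> < \<bar>int n - int m\<bar> \<longrightarrow>
        gain m n s * cmod (y (int_encode s)) * q ^ j \<le> q ^ nat \<bar>int n - int m\<bar>)"
  proof (intro eventually_ball_finite[OF S] ballI)
    fix s assume "s \<in> S"
    then have "\<omega> s \<noteq> 0" using y(1) encode_in_supp[of s] by (auto simp: S_def)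
    then obtain M where M: "\<And>m n. \<bar>s\<bar> < \<bar>int n - int m\<bar> \<Longrightarrow> gain m n s \<le> M * q ^ nat \<bar>int n - int m\<bar>"
      using gain_bound by blast
    have "(\<lambda>j. M * cmod (y (int_encode s)) * q ^ j) \<longlonglongrightarrow> 0"
      using q by (intro tendsto_mult_right_zero LIMSEQ_power_zero) auto
    then have "\<forall>\<^sub>F j in sequentially. M * cmod (y (int_encode s)) * q ^ j < 1"
      by (rule order_tendstoD) simp
    moreover have "\<forall>\<^sub>F j in sequentially. nat \<bar>s\<bar> \<le> j" by (rule eventually_ge_at_top)
    ultimately show "\<forall>\<^sub>F j in sequentially. \<bar>s\<bar> \<le> int j \<and>
      (\<forall>m n. \<bar>s\<bar> < \<bar>int n - int m\<bar> \<longrightarrow>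
        gain m n s * cmod (y (int_encode s)) * q ^ j \<le> q ^ nat \<bar>int n - int m\<bar>)"
    proof eventually_elim
      case (elim j)
      show ?case
      proof (intro conjI allI impI)
        show "\<bar>s\<bar> \<le> int j" using elim by simp
        fix m n assume "\<bar>s\<bar> < \<bar>int n - int m\<bar>"
        then have "gain m n s * (cmod (y (int_encode s)) * q ^ j)
            \<le> M * q ^ nat \<bar>int n - int m\<bar> * (cmod (y (int_encode s)) * q ^ j)"
          using q by (intro mult_right_mono M) auto
        also have "\<dots> = (M * cmod (y (int_encode s)) * q ^ j) * q ^ nat \<bar>int n - int m\<bar>" by simp
        also have "\<dots> \<le> 1 * q ^ nat \<bar>int n - int m\<bar>"
          using elim q by (intro mult_right_mono) auto
        finally show "gain m n s * cmod (y (int_encode s)) * q ^ j \<le> q ^ nat \<bar>int n - int m\<bar>" by simp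
      qed
    qed
  qed
  then show ?thesis
  proof eventually_elim
    case (elim j)
    show ?case
      unfolding tame_def
    proof (intro conjI allI impI)
      fix s assume "int j < \<bar>s\<bar>"
      with elim show "y (int_encode s) = 0" by (force simp: S_def)
    next
      fix s :: int and m n assume "\<bar>s\<bar> < \<bar>int n - int m\<bar>"
      with elim q show "gain m n s * cmod (y (int_encode s)) * q ^ j \<le> q ^ nat \<bar>int n - int m\<bar>"
        by (cases "s \<in> S") (auto simp: S_def)
    qed
  qed
qed

subsection \<open>The frequently universal vector\<close>

text \<open>
  Every \<open>l\<close> is the first component of infinitely many codes \<open>j\<close>, hence also of one that is large
  enough for the \<open>l\<close>-th vector to be tame.
\<close>

definition target :: "nat \<Rightarrow> nat \<Rightarrow> complex" where
  "target j = (if tame (rat_seq supp (fst (prod_decode j))) j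
               then rat_seq supp (fst (prod_decode j)) else (\<lambda>n. 0))"

lemma tame_target: "tame (target j) j"
proof (cases "tame (rat_seq supp (fst (prod_decode j))) j")
  case False
  \<comment> \<open>The fallback zero vector is tame for every index.\<close>
  then show ?thesis using q by (simp add: target_def tame_def)
qed (simp add: target_def)

lemma target_in_X: "target j \<in> carrier X"
  using rat_seq_in_c0_space[of supp] by (simp add: target_def)

lemma target_eq_rat_seq:
  obtains j where "J \<le> j" "target j = rat_seq supp l"
proof -
  obtain J' where J': "\<And>j. J' \<le> j \<Longrightarrow> tame (rat_seq supp l) j"
    using eventually_tame[OF rat_seq_in_c0_space finite_support_rat_seq, of l]
    by (auto simp: eventually_sequentially)
  define j where "j = prod_encode (l, max J J')"
  have "max J J' \<le> j" unfolding j_def by (rule le_prod_encode_2)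
  with J'[of j] show ?thesis by (intro that[of j]) (simp_all add: target_def j_def)
qed

text \<open>Solving \<open>funpow_shift\<close> for the argument gives this right inverse, with
  \<open>p\<close> the coordinate after moving right by \<open>centre i\<close>. Where
  \<open>\<omega>\<close> vanishes at the original coordinate, so does the target.\<close>

definition block :: "nat \<Rightarrow> int \<Rightarrow> complex" where
  "block i p = complex_of_real (\<omega> p / (\<mu> (centre i) * \<omega> (p - int (centre i))))
     * target (jump i) (int_encode (p - int (centre i)))"

text \<open>A tame target vanishes beyond distance \<open>jump i\<close> from the origin, so this
  window holds the whole block.\<close>

definition in_block :: "nat \<Rightarrow> int \<Rightarrow> bool" where
  "in_block i p \<longleftrightarrow> \<bar>p - int (centre i)\<bar> \<le> int (jump i)"

lemma in_block_unique:
  assumes "in_block i p" "in_block i' p"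
  shows "i = i'"
  using assms centre_separated_abs[of i i'] by (fastforce simp: in_block_def)

definition universal :: "nat \<Rightarrow> complex" where
  "universal n = (if \<exists>i. in_block i (int_decode n)
     then block (SOME i. in_block i (int_decode n)) (int_decode n) else 0)"

lemma universal_block: "in_block i p \<Longrightarrow> universal (int_encode p) = block i p"
  unfolding universal_def int_encode_inverse
  using some_equality[of "\<lambda>i. in_block i p"] in_block_unique by metis

lemma universal_0: "(\<And>i. \<not> in_block i p) \<Longrightarrow> universal (int_encode p) = 0"
  by (simp add: universal_def)

text \<open>The part \<open>jump i\<close> of the distance pays for the factor
  \<open>q ^ jump i\<close> in \<open>tame\<close>, leaving \<open>q ^ r\<close>. Index
  \<open>m = 0\<close> controls the entries of the block, another centre its interference.\<close>

lemma cmod_block_le: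
  assumes "in_block i p" "jump i + r \<le> nat \<bar>int (centre i) - int m\<bar>" "0 < r"
  shows "\<mu> m * (\<omega> (p - int m) / \<omega> p) * cmod (block i p) \<le> q ^ r"
proof -
  define s where "s = p - int (centre i)"
  define D where "D = nat \<bar>int (centre i) - int m\<bar>"
  have "\<bar>s\<bar> < \<bar>int (centre i) - int m\<bar>"
    using assms by (auto simp: in_block_def s_def)
  then have "gain m (centre i) s * cmod (target (jump i) (int_encode s)) * q ^ jump i \<le> q ^ D"
    using tame_target[of "jump i"] by (auto simp: tame_def D_def)
  also have "\<dots> \<le> q ^ (jump i + r)"
    using assms q by (intro power_decreasing) (auto simp: D_def)
  finally have g: "gain m (centre i) s * cmod (target (jump i) (int_encode s)) \<le> q ^ r"
    using q by (simp add: power_add mult.commute)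
  have "\<mu> m * (\<omega> (p - int m) / \<omega> p) * cmod (block i p)
      \<le> gain m (centre i) s * cmod (target (jump i) (int_encode s))"
  proof (cases "\<omega> p = 0")
    case True
    then show ?thesis using gain_nonneg by simp
  next
    case False
    have "gain m (centre i) s = \<mu> m / \<mu> (centre i) * (\<omega> (p - int m) / \<omega> s)"
      by (simp add: gain_def s_def)
    then have "\<mu> m * (\<omega> (p - int m) / \<omega> p) * cmod (block i p)
      = gain m (centre i) s * cmod (target (jump i) (int_encode s))"
      using False \<omega>_nonneg[of p] \<omega>_nonneg[of s] \<mu>_pos[of "centre i"]
      by (simp add: block_def norm_mult norm_divide flip: s_def)
    then show ?thesis by simp
  qed
  with g show ?thesis by simp
qed

text \<open>By the estimate with \<open>m = 0\<close>, entries of block \<open>i\<close> are at most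
  \<open>q ^ i\<close> in modulus, so those of modulus at least \<open>e\<close> lie in finitely
  many finite blocks.\<close>

lemma universal_in_X: "universal \<in> carrier X"
proof -
  have supp: "universal n = 0" if "n \<notin> supp" for n
  proof -
    have "\<omega> (int_decode n) = 0" using that by (simp add: supp_def)
    then show ?thesis by (simp add: universal_def block_def)
  qed
  have "\<forall>\<^sub>F n in sequentially. dist (universal n) 0 < e" if "0 < e" for e :: real
  proof -
    from real_arch_pow_inv[OF that q(2)] obtain r where r: "q ^ r < e" by blast
    have "finite (\<Union>i\<le>r. int_encode ` {p. in_block i p})"
    proof (intro finite_UN_I finite_imageI)
      fix i
      have "{p. in_block i p} \<subseteq> {int (centre i) - int (jump i)..int (centre i) + int (jump i)}"
        by (auto simp: in_block_def)
      then show "finite {p. in_block i p}" by (rule finite_subset) simp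
    qed simp
    moreover have "n \<in> (\<Union>i\<le>r. int_encode ` {p. in_block i p})" if e: "e \<le> cmod (universal n)" for n
    proof -
      define p where "p = int_decode n"
      have n: "n = int_encode p" by (simp add: p_def)
      have "\<omega> p \<noteq> 0" using e \<open>0 < e\<close> supp[of n] by (auto simp: n encode_in_supp)
      moreover have "\<exists>i. in_block i p"
        using e \<open>0 < e\<close> universal_0[of p] by (cases "\<exists>i. in_block i p") (auto simp: n)
      then obtain i where i: "in_block i p" ..
      moreover have "0 < centre i - jump i" "jump i + (centre i - jump i) \<le> nat \<bar>int (centre i) - int 0\<bar>"
        using centre_ge[of i] by auto
      ultimately have "cmod (universal n) \<le> q ^ (centre i - jump i)"
        using cmod_block_le[of i p "centre i - jump i" 0] by (simp add: n universal_block \<mu>_0)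
      also have "\<dots> \<le> q ^ i" using centre_ge[of i] q by (intro power_decreasing) auto
      finally have "q ^ r < q ^ i" using e r by simp
      then have "i < r" using q by (simp add: power_strict_decreasing_iff)
      with i show ?thesis by (auto simp: n)
    qed
    ultimately have "finite {n. e \<le> cmod (universal n)}" using finite_subset by (metis (no_types, lifting) mem_Collect_eq subsetI)
    then show ?thesis
      by (simp flip: cofinite_eq_sequentially add: eventually_cofinite not_less)
  qed
  then have "universal \<longlonglongrightarrow> 0" by (rule tendstoI)
  with supp show ?thesis by simp
qed

section \<open>Approximation of the targets along the centres\<close>

definition scaled :: "nat \<Rightarrow> (nat \<Rightarrow> complex) \<Rightarrow> nat \<Rightarrow> complex" where
  "scaled n f = complex_of_real (\<mu> n) \<odot>\<^bsub>X\<^esub> (shift ^^ n) f"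

lemma scaled_closed: "f \<in> carrier X \<Longrightarrow> scaled n f \<in> carrier X"
  using funpow_shift_closed[of f n] by (auto simp: scaled_def intro: tendsto_eq_intros)

lemma scaled_universal:
  "scaled m universal (int_encode k)
    = complex_of_real (\<mu> m * (\<omega> k / \<omega> (k + int m))) * universal (int_encode (k + int m))"
  by (simp add: scaled_def funpow_shift[OF universal_in_X])

text \<open>Block \<open>i\<close> returns exactly to its target. Elsewhere the target is zero, and
  each coordinate meets at most one other block, so a bound for a single block bounds the
  supremum.\<close>

lemma scaled_universal_near_target:
  "nrm_dist X (scaled (centre i) universal) (target (jump i)) \<le> q ^ jump i"
  unfolding nrm_dist_c0_space_le_iff[OF scaled_closed[OF universal_in_X] target_in_X]
proof
  fix n
  define m j k where "m = centre i" and "j = jump i" and "k = int_decode n"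
  have n: "n = int_encode k" by (simp add: k_def)
  have outside: "target j (int_encode k) = 0" if "int j < \<bar>k\<bar>"
    using that tame_target[of j] by (auto simp: tame_def)
  consider "in_block i (k + int m)" | i' where "in_block i' (k + int m)" "i' \<noteq> i"
    | "\<And>i'. \<not> in_block i' (k + int m)" by blast
  then have "cmod (scaled m universal (int_encode k) - target j (int_encode k)) \<le> q ^ j"
  proof cases
    case 1
    have "scaled m universal (int_encode k) = target j (int_encode k)"
    proof (cases "\<omega> k = 0")
      case True
      then have "target j (int_encode k) = 0"
        using target_in_X[of j] encode_in_supp[of k] by auto
      with True show ?thesis by (simp add: scaled_universal)
    next
      case False
      with \<omega>_add_nonzero[of k m] \<mu>_pos[of m] show ?thesis
        by (simp add: scaled_universal universal_block[OF 1] block_def flip: m_def j_def)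
    qed
    with q show ?thesis by simp
  next
    case 2
    have sep: "int (jump i') + int j + 2 \<le> \<bar>int (centre i') - int m\<bar>"
      using centre_separated_abs[OF 2(2)] by (simp add: m_def j_def)
    have "\<not> in_block i (k + int m)" using 2 in_block_unique by blast
    then have "target j (int_encode k) = 0" by (intro outside) (simp add: in_block_def m_def j_def)
    then have "cmod (scaled m universal (int_encode k) - target j (int_encode k))
        = \<mu> m * (\<omega> (k + int m - int m) / \<omega> (k + int m)) * cmod (block i' (k + int m))"
      using \<mu>_pos[of m] \<omega>_nonneg
      by (simp add: scaled_universal universal_block[OF 2(1)] norm_mult norm_divide)
    \<comment> \<open>The gap exceeds the index of the interfering block by \<open>j + 2\<close>,
      which serves as \<open>r\<close>.\<close>
    also have "\<dots> \<le> q ^ (j + 2)" using sep by (intro cmod_block_le 2) auto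
    also have "\<dots> \<le> q ^ j" using q by (intro power_decreasing) auto
    finally show ?thesis .
  next
    case 3
    then have "target j (int_encode k) = 0"
      by (intro outside) (use 3[of i] in \<open>simp add: in_block_def m_def j_def\<close>)
    with q show ?thesis by (simp add: scaled_universal universal_0[OF 3])
  qed
  then show "cmod (scaled (centre i) universal n - target (jump i) n) \<le> q ^ jump i"
    by (simp add: n m_def j_def)
qed

lemma frequently_universal_scaled: "frequently_universal X scaled"
  unfolding frequently_universal_def
proof (intro bexI[OF _ universal_in_X] allI impI)
  fix U assume "openin (nrm_topology X) U \<and> U \<noteq> {}"
  then have U: "openin (c0.mtopology supp) U" "U \<noteq> {}" by (simp_all add: nrm_topology_def)
  then obtain f where f: "f \<in> U" "f \<in> carrier X"
    unfolding c0.openin_mtopology by blast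
  with U obtain e where e: "0 < e" "c0.mball supp f e \<subseteq> U"
    unfolding c0.openin_mtopology by blast
  obtain l where l: "nrm_dist X f (rat_seq supp l) < e / 2"
    using rat_seq_dense[OF f(2)] e(1) half_gt_zero by metis
  obtain J where J: "q ^ J < e / 2" using real_arch_pow_inv[of "e / 2"] e(1) q(2) by auto
  obtain j where j: "J \<le> j" "target j = rat_seq supp l" by (rule target_eq_rat_seq)
  \<comment> \<open>By \<open>jump_arith\<close> these are centres whose block has target
    \<open>target j\<close>.\<close>
  define b where "b t = centre (2 ^ Suc j * t + (2 ^ j - 1))" for t
  have bU: "scaled (b t) universal \<in> U" for t
  proof -
    have "nrm_dist X (scaled (b t) universal) (target j) \<le> q ^ j"
      using scaled_universal_near_target[of "2 ^ Suc j * t + (2 ^ j - 1)"]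
      unfolding jump_arith b_def .
    also have "\<dots> \<le> q ^ J" using j(1) q by (intro power_decreasing) auto
    finally have "nrm_dist X (scaled (b t) universal) (target j) < e / 2" using J by simp
    moreover have "nrm_dist X f (scaled (b t) universal)
        \<le> nrm_dist X f (target j) + nrm_dist X (target j) (scaled (b t) universal)"
      by (intro c0.triangle f(2) target_in_X scaled_closed universal_in_X)
    ultimately have "nrm_dist X f (scaled (b t) universal) < e"
      using l j(2) c0.commute[of supp "target j" "scaled (b t) universal"] by simp
    then have "scaled (b t) universal \<in> c0.mball supp f e"
      using f(2) scaled_closed[OF universal_in_X] by (metis c0.in_mball)
    with e(2) show ?thesis by blast
  qed
  show "0 < lower_density {n. 1 \<le> n \<and> scaled n universal \<in> U}"
  \<comment> \<open>From \<open>centre_le\<close>, \<open>b t\<close> is at most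
    \<open>10 * 2 ^ j * t + 5 * 2 ^ j\<close>, and \<open>16 = 2 ^ 4\<close> exceeds both
    coefficients.\<close>
  proof (rule lower_density_pos[where b = b and L = "2 ^ (j + 4)"])
    show "inj b"
    proof (rule injI)
      fix x y assume "b x = b y"
      then have "2 ^ Suc j * x + (2 ^ j - 1) = 2 ^ Suc j * y + (2 ^ j - 1)"
        unfolding b_def strict_mono_eq[OF strict_mono_centre] .
      then show "x = y" by (simp only: add_right_cancel mult_cancel1) simp
    qed
    show "1 \<le> b t" for t using centre_ge[of "2 ^ Suc j * t + (2 ^ j - 1)"] unfolding b_def by linarith
    then show "b t \<in> {n. 1 \<le> n \<and> scaled n universal \<in> U}" for t using bU by simp
    show "b t \<le> 2 ^ (j + 4) * Suc t" for t
    proof -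
      have "b t \<le> 5 * (2 ^ Suc j * t + (2 ^ j - 1)) + 1" unfolding b_def by (rule centre_le)
      also have "\<dots> \<le> 5 * (2 ^ Suc j * t + 2 ^ j)"
      proof -
        obtain c :: nat where "2 ^ j = Suc c" by (metis gr0_implies_Suc zero_less_numeral zero_less_power)
        then show ?thesis by simp
      qed
      also have "\<dots> \<le> 2 ^ (j + 4) * Suc t" by (simp add: power_add algebra_simps)
      finally show ?thesis .
    qed
  qed
qed

lemma ex_frequently_universal_not_recurrent:
  assumes "\<alpha> < 1 \<and> \<beta> < 1 \<or> 1 < \<alpha> \<and> 1 < \<beta>" and "(\<lambda>n. \<mu> n / \<mu> (n + \<tau>)) \<longlonglongrightarrow> a"
  shows "\<exists>(lam :: nat \<Rightarrow> complex) (X :: (nat \<Rightarrow> complex) normed_module)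
            (T :: (nat \<Rightarrow> complex) \<Rightarrow> (nat \<Rightarrow> complex)).
           complex_banach_space X \<and>
           infinite_dimensional X \<and>
           separable_space (nrm_topology X) \<and>
           bounded_linear_operator X T \<and>
           \<not> recurrent_operator X T \<and>
           (\<forall>n\<ge>1. lam (n + \<tau>) \<noteq> 0) \<and>
           (\<lambda>n. cmod (lam n) / cmod (lam (n + \<tau>))) \<longlonglongrightarrow> a \<and>
           frequently_universal X (\<lambda>n x. lam n \<odot>\<^bsub>X\<^esub> (T ^^ n) x)"
proof (intro exI conjI)
  show "\<not> recurrent_operator X shift" by (rule not_recurrent_shift[OF assms(1)])
  show "\<forall>n\<ge>1. complex_of_real (\<mu> (n + \<tau>)) \<noteq> 0" using \<mu>_pos by (simp add: less_imp_neq[THEN not_sym])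
  show "(\<lambda>n. cmod (complex_of_real (\<mu> n)) / cmod (complex_of_real (\<mu> (n + \<tau>)))) \<longlonglongrightarrow> a"
    using assms(2) \<mu>_pos by (simp add: less_imp_le)
  show "frequently_universal X (\<lambda>n x. complex_of_real (\<mu> n) \<odot>\<^bsub>X\<^esub> (shift ^^ n) x)"
    using frequently_universal_scaled by (simp only: scaled_def[abs_def])
qed (simp_all add: complex_banach_space_c0_space infinite_dimensional_c0_space infinite_supp
      separable_c0_space bounded_linear_operator_shift)

end

section \<open>Choice of weights and scalars\<close>

theorem proposition1p8:
  fixes a :: real and \<tau> :: nat
  assumes "0 \<le> a" and "a \<noteq> 1" and "1 \<le> \<tau>"
  shows "\<exists>(lam :: nat \<Rightarrow> complex) (X :: (nat \<Rightarrow> complex) normed_module)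
            (T :: (nat \<Rightarrow> complex) \<Rightarrow> (nat \<Rightarrow> complex)).
           complex_banach_space X \<and>
           infinite_dimensional X \<and>
           separable_space (nrm_topology X) \<and>
           bounded_linear_operator X T \<and>
           \<not> recurrent_operator X T \<and>
           (\<forall>n\<ge>1. lam (n + \<tau>) \<noteq> 0) \<and>
           (\<lambda>n. cmod (lam n) / cmod (lam (n + \<tau>))) \<longlonglongrightarrow> a \<and>
           frequently_universal X (\<lambda>n x. lam n \<odot>\<^bsub>X\<^esub> (T ^^ n) x)"
proof (cases "a = 0")
  case True
  \<comment> \<open>The factorial drives the quotients to zero, and the base \<open>4\<close> is
    \<open>1 / (q * \<alpha>)\<close> for the parameters below.\<close>
  let ?\<mu> = "\<lambda>n. 4 ^ n * fact n :: real"
  interpret weighted_shift "1/2" 0 "1/2" ?\<mu>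
    by unfold_locales (auto simp: algebra_simps)
  have "?\<mu> n / ?\<mu> (n + \<tau>) \<le> inverse (real (Suc n))" for n
  proof -
    have "?\<mu> n * real (Suc n) \<le> ?\<mu> (Suc n)" by simp
    also have "\<dots> \<le> ?\<mu> (n + \<tau>)"
      using assms(3) by (intro mult_mono power_increasing fact_mono) auto
    finally show ?thesis by (simp add: field_simps)
  qed
  then have "(\<lambda>n. ?\<mu> n / ?\<mu> (n + \<tau>)) \<longlonglongrightarrow> 0"
    by (intro tendsto_sandwich[OF _ _ tendsto_const LIMSEQ_inverse_real_of_nat] always_eventually) auto
  with True show ?thesis by (intro ex_frequently_universal_not_recurrent) auto
next
  case False
  \<comment> \<open>With \<open>t ^ (2 * \<tau>) = a\<close>, the scalars
    \<open>(1 / t\<^sup>2) ^ n\<close> have quotient exactly \<open>a\<close>.\<close>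
  define t where "t = a powr (1 / (2 * real \<tau>))"
  have a: "0 < a" using False assms(1) by simp
  then have t: "0 < t" by (simp add: t_def)
  have "(t\<^sup>2) ^ \<tau> = a"
    using a assms(3) by (simp add: t_def powr_powr flip: powr_realpow power_mult)
  then have lim: "(\<lambda>n. (1 / t\<^sup>2) ^ n / (1 / t\<^sup>2) ^ (n + \<tau>)) \<longlonglongrightarrow> a"
    using t by (simp add: power_add power_mult power_divide field_simps)
  show ?thesis
  proof (cases "a < 1")
    case True
    have t1: "t < 1" using powr_less_mono2[of "1 / (2 * real \<tau>)" a 1] a assms(3) True by (simp add: t_def)
    \<comment> \<open>Here \<open>q * \<alpha>\<close> is \<open>t\<^sup>2\<close>, so
      \<open>\<mu>_forward\<close> is an equality; the shift is unilateral.\<close>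
    interpret weighted_shift t 0 t "\<lambda>n. (1 / t\<^sup>2) ^ n"
      using t t1 by unfold_locales (auto simp: field_simps power2_eq_square)
    show ?thesis using t1 lim by (intro ex_frequently_universal_not_recurrent) auto
  next
    case False
    then have t1: "1 < t" using assms(2,3) by (simp add: t_def gr_one_powr)
    \<comment> \<open>The weights enclose the rate \<open>t\<^sup>2\<close> with a factor
      \<open>t\<close> to spare on either side: both growth conditions become equalities with
      \<open>q = 1 / t\<close>, and both weights exceed \<open>1\<close>.\<close>
    interpret weighted_shift "t ^ 3" t "1 / t" "\<lambda>n. (1 / t\<^sup>2) ^ n"
      using t t1 by unfold_locales (auto simp: field_simps power2_eq_square power3_eq_cube)
    show ?thesis using t1 lim by (intro ex_frequently_universal_not_recurrent) auto
  qed
qed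

end
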